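(* Let $X$ be a topological space. The following are equivalent: (1) $X$ is $Q^*$-normal. (2) For any disjoint $Q^*$-closed sets $H$ and $K$ of $X$, there exist disjoint $g$-open sets $U$ and $V$ of $X$ such that $H\subset U$ and $K\subset V$. (3) For any disjoint $Q^*$-closed sets $H$ and $K$ of $X$, there exist disjoint $Q^*g$-open sets $U$ and $V$ of $X$ such that $H\subset U$ and $K\subset V$. (4) For any $Q^*$-closed set $H$ of $X$ and any $Q^*$-open set $V$ of $X$ containing $H$, there exists a $g$-open set $U$ of $X$ such that $H\subset U\subset cl(U)\subset V$. (5) For any $Q^*$-closed set $H$ of $X$ and any $Q^*$-open set $V$ of $X$ containing $H$, there exists a $Q^*g$-open set $U$ of $X$ such that $H\subset U\subset cl(U)\subset V$.
   Context: No separation axioms are assumed on topological spaces. The symbol $\subset$ denotes (not necessarily proper) inclusion; $cl(A)$ and $int(A)$ denote closure and interior. A subset $A$ of $X$ is $Q^*$-closed if $A$ is closed and $int(A)=\emptyset$; $A$ is $Q^*$-open if $X-A$ is $Q^*$-closed. A subset $A$ of $X$ is $g$-closed if $cl(A)\subset W$ whenever $A\subset W$ and $W$ is open in $X$; it is $g$-open if $X-A$ is $g$-closed. A subset $A$ of $X$ is $Q^*g$-closed if $cl(A)\subset W$ whenever $A\subset W$ and $W$ is $Q^*$-open in $X$; it is $Q^*g$-open if $X-A$ is $Q^*g$-closed. A space $X$ is $Q^*$-normal if for every pair of disjoint $Q^*$-closed subsets $A$, $B$ of $X$ there exist disjoint open sets $U$, $V$ of $X$ such that $A\subset U$ and $B\subset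 V$. *)

theory Defs
  imports "HOL-Analysis.Abstract_Topology"
begin

text \<open>A space is an arbitrary \<^typ>\<open>'a topology\<close>, with its own carrier; each notion below is a
  property of subsets of \<^term>\<open>topspace X\<close>.\<close>

definition Qstar_closedin :: "'a topology \<Rightarrow> 'a set \<Rightarrow> bool" where
  "Qstar_closedin X A \<longleftrightarrow> closedin X A \<and> X interior_of A = {}"

definition Qstar_openin :: "'a topology \<Rightarrow> 'a set \<Rightarrow> bool" where
  "Qstar_openin X A \<longleftrightarrow> A \<subseteq> topspace X \<and> Qstar_closedin X (topspace X - A)"

definition g_closedin :: "'a topology \<Rightarrow> 'a set \<Rightarrow> bool" where
  "g_closedin X A \<longleftrightarrow> A \<subseteq> topspace X \<and> (\<forall>W. openin X W \<and> A \<subseteq> W \<longrightarrow> X closure_of A \<subseteq> W)"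

definition g_openin :: "'a topology \<Rightarrow> 'a set \<Rightarrow> bool" where
  "g_openin X A \<longleftrightarrow> A \<subseteq> topspace X \<and> g_closedin X (topspace X - A)"

definition Qstar_g_closedin :: "'a topology \<Rightarrow> 'a set \<Rightarrow> bool" where
  "Qstar_g_closedin X A \<longleftrightarrow>
     A \<subseteq> topspace X \<and> (\<forall>W. Qstar_openin X W \<and> A \<subseteq> W \<longrightarrow> X closure_of A \<subseteq> W)"

definition Qstar_g_openin :: "'a topology \<Rightarrow> 'a set \<Rightarrow> bool" where
  "Qstar_g_openin X A \<longleftrightarrow> A \<subseteq> topspace X \<and> Qstar_g_closedin X (topspace X - A)"

definition Qstar_normal_space :: "'a topology \<Rightarrow> bool" where
  "Qstar_normal_space X \<longleftrightarrow>
     (\<forall>A B. Qstar_closedin X A \<and> Qstar_closedin X B \<and> disjnt A B \<longrightarrow>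
        (\<exists>U V. openin X U \<and> openin X V \<and> disjnt U V \<and> A \<subseteq> U \<and> B \<subseteq> V))"

end

theory Submission imports Defs
begin

text \<open>The one non-formal point is that every \<open>Q\<^sup>*g\<close>-open set \<open>U\<close> containing a
  \<open>Q\<^sup>*\<close>-closed set \<open>H\<close> already contains it in its interior: the \<open>Q\<^sup>*\<close>-open set \<open>X - H\<close> contains
  \<open>X - U\<close>, hence its closure. So generalised open sets can be replaced by their interiors.\<close>

lemma openin_imp_g_openin: "openin X U \<Longrightarrow> g_openin X U"
  by (simp add: g_openin_def g_closedin_def openin_subset closure_of_closedin closedin_diff)

text \<open>Every \<open>Qstar_openin\<close> set is open, being the complement of a closed set
  within the carrier. The closure condition is therefore tested against fewer sets
  \<open>W\<close>.\<close>

lemma g_openin_imp_Qstar_g_openin: "g_openin X U \<Longrightarrow> Qstar_g_openin X U"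
  unfolding g_openin_def g_closedin_def Qstar_g_openin_def Qstar_g_closedin_def
    Qstar_openin_def Qstar_closedin_def
  by (simp add: openin_closedin_eq)

lemma Qstar_openin_diff: "Qstar_closedin X H \<Longrightarrow> Qstar_openin X (topspace X - H)"
  by (simp add: Qstar_openin_def Qstar_closedin_def closedin_subset double_diff)

lemma Qstar_closedin_subset_interior_of:
  assumes "Qstar_closedin X H" "Qstar_g_openin X U" "H \<subseteq> U"
  shows "H \<subseteq> X interior_of U"
proof -
  have "X closure_of (topspace X - U) \<subseteq> topspace X - H"
    using assms Qstar_openin_diff[OF assms(1)]
    unfolding Qstar_g_openin_def Qstar_g_closedin_def by blast
  moreover have "H \<subseteq> topspace X"
    using assms(1) by (simp add: Qstar_closedin_def closedin_subset)
  ultimately show ?thesis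
    by (auto simp: interior_of_closure_of)
qed

text \<open>Normality is applied to \<open>H\<close> and the complement of \<open>V\<close>. The
  open set \<open>W\<close> around that complement keeps the closure of \<open>U\<close> inside
  \<open>V\<close>.\<close>

lemma Qstar_normal_space_imp_closure_nbhd:
  assumes "Qstar_normal_space X" "Qstar_closedin X H" "Qstar_openin X V" "H \<subseteq> V"
  obtains U where "openin X U" "H \<subseteq> U" "U \<subseteq> X closure_of U" "X closure_of U \<subseteq> V"
proof -
  have "Qstar_closedin X (topspace X - V)" "disjnt H (topspace X - V)"
    using assms by (auto simp: Qstar_openin_def disjnt_iff)
  with assms obtain U W where UW: "openin X U" "openin X W" "disjnt U W"
      "H \<subseteq> U" "topspace X - V \<subseteq> W"
    unfolding Qstar_normal_space_def by metis
  \<comment> \<open>The complement of \<open>W\<close> is closed and contains \<open>U\<close>,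
    because \<open>U\<close> and \<open>W\<close> are disjoint.\<close>
  have "X closure_of U \<subseteq> topspace X - W"
    using UW by (intro closure_of_minimal) (auto simp: disjnt_iff dest: openin_subset)
  with UW have "X closure_of U \<subseteq> V"
    by blast
  with UW that show thesis
    by (simp add: closure_of_subset openin_subset)
qed

text \<open>The interiors of \<open>U\<close> and \<open>V\<close> are open and still disjoint, and
  they still contain \<open>H\<close> and \<open>K\<close> by
  \<open>Qstar_closedin_subset_interior_of\<close>.\<close>

lemma Qstar_normal_spaceI_Qstar_g_openin:
  assumes "\<And>H K. \<lbrakk>Qstar_closedin X H; Qstar_closedin X K; disjnt H K\<rbrakk> \<Longrightarrow>
    \<exists>U V. Qstar_g_openin X U \<and> Qstar_g_openin X V \<and> disjnt U V \<and> H \<subseteq> U \<and> K \<subseteq> V"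
  shows "Qstar_normal_space X"
  unfolding Qstar_normal_space_def
proof (intro allI impI, elim conjE)
  fix H K assume HK: "Qstar_closedin X H" "Qstar_closedin X K" "disjnt H K"
  then obtain U V where UV: "Qstar_g_openin X U" "Qstar_g_openin X V" "disjnt U V"
      "H \<subseteq> U" "K \<subseteq> V"
    using assms by blast
  have "disjnt (X interior_of U) (X interior_of V)"
    using UV(3) by (meson disjnt_subset1 disjnt_subset2 interior_of_subset)
  then show "\<exists>U V. openin X U \<and> openin X V \<and> disjnt U V \<and> H \<subseteq> U \<and> K \<subseteq> V"
    using HK UV Qstar_closedin_subset_interior_of by (metis openin_interior_of)
qed

text \<open>For disjoint \<open>H\<close> and \<open>K\<close>, the assumption is used with the
  complement of \<open>K\<close> as \<open>V\<close>. The separating open sets are then the interior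
  of \<open>U\<close> and the complement of its closure.\<close>

lemma Qstar_normal_spaceI_closure_nbhd:
  assumes "\<And>H V. \<lbrakk>Qstar_closedin X H; Qstar_openin X V; H \<subseteq> V\<rbrakk> \<Longrightarrow>
    \<exists>U. Qstar_g_openin X U \<and> H \<subseteq> U \<and> X closure_of U \<subseteq> V"
  shows "Qstar_normal_space X"
  unfolding Qstar_normal_space_def
proof (intro allI impI, elim conjE)
  fix H K assume HK: "Qstar_closedin X H" "Qstar_closedin X K" "disjnt H K"
  then have sub: "H \<subseteq> topspace X" "K \<subseteq> topspace X"
    by (simp_all add: Qstar_closedin_def closedin_subset)
  then have "H \<subseteq> topspace X - K"
    using HK by (auto simp: disjnt_iff)
  then obtain U where U: "Qstar_g_openin X U" "H \<subseteq> U" "X closure_of U \<subseteq> topspace X - K"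
    using assms HK Qstar_openin_diff by blast
  \<comment> \<open>A \<open>Qstar_g_openin\<close> set lies in the carrier by definition, which
    gives the side condition of \<open>closure_of_subset\<close>.\<close>
  have "X interior_of U \<subseteq> X closure_of U"
    using U(1) by (meson Qstar_g_openin_def closure_of_subset interior_of_subset order_trans)
  then have "disjnt (X interior_of U) (topspace X - X closure_of U)"
    by (auto simp: disjnt_iff)
  moreover have "openin X (topspace X - X closure_of U)"
    by (simp add: openin_diff)
  moreover have "K \<subseteq> topspace X - X closure_of U"
    using U sub by blast
  ultimately show "\<exists>U V. openin X U \<and> openin X V \<and> disjnt U V \<and> H \<subseteq> U \<and> K \<subseteq> V"
    using Qstar_closedin_subset_interior_of[OF HK(1) U(1,2)] by (meson openin_interior_of)
qed

theorem theorem2p12: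
  fixes X :: "'a topology"
  shows
   "(Qstar_normal_space X \<longleftrightarrow>
      (\<forall>H K. Qstar_closedin X H \<and> Qstar_closedin X K \<and> disjnt H K \<longrightarrow>
        (\<exists>U V. g_openin X U \<and> g_openin X V \<and> disjnt U V \<and> H \<subseteq> U \<and> K \<subseteq> V))) \<and>
    (Qstar_normal_space X \<longleftrightarrow>
      (\<forall>H K. Qstar_closedin X H \<and> Qstar_closedin X K \<and> disjnt H K \<longrightarrow>
        (\<exists>U V. Qstar_g_openin X U \<and> Qstar_g_openin X V \<and> disjnt U V \<and> H \<subseteq> U \<and> K \<subseteq> V))) \<and>
    (Qstar_normal_space X \<longleftrightarrow>
      (\<forall>H V. Qstar_closedin X H \<and> Qstar_openin X V \<and> H \<subseteq> V \<longrightarrow>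
        (\<exists>U. g_openin X U \<and> H \<subseteq> U \<and> U \<subseteq> X closure_of U \<and> X closure_of U \<subseteq> V))) \<and>
    (Qstar_normal_space X \<longleftrightarrow>
      (\<forall>H V. Qstar_closedin X H \<and> Qstar_openin X V \<and> H \<subseteq> V \<longrightarrow>
        (\<exists>U. Qstar_g_openin X U \<and> H \<subseteq> U \<and> U \<subseteq> X closure_of U \<and> X closure_of U \<subseteq> V)))"
  (is "(?N \<longleftrightarrow> ?g) \<and> (?N \<longleftrightarrow> ?Qg) \<and> (?N \<longleftrightarrow> ?cl_g) \<and> (?N \<longleftrightarrow> ?cl_Qg)")
proof -
  \<comment> \<open>The equivalences follow from two cycles that meet at \<open>?N\<close>: one runs
    through \<open>?g\<close> and \<open>?Qg\<close>, the other through \<open>?cl_g\<close> and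
    \<open>?cl_Qg\<close>. In each, only the return to \<open>?N\<close> passes to
    interiors.\<close>
  have "?N \<Longrightarrow> ?g"
    unfolding Qstar_normal_space_def by (meson openin_imp_g_openin)
  moreover have "?g \<Longrightarrow> ?Qg"
    by (meson g_openin_imp_Qstar_g_openin)
  moreover have "?Qg \<Longrightarrow> ?N"
    by (rule Qstar_normal_spaceI_Qstar_g_openin) blast
  moreover have "?N \<Longrightarrow> ?cl_g"
    by (meson Qstar_normal_space_imp_closure_nbhd openin_imp_g_openin)
  moreover have "?cl_g \<Longrightarrow> ?cl_Qg"
    by (meson g_openin_imp_Qstar_g_openin)
  moreover have "?cl_Qg \<Longrightarrow> ?N"
    by (rule Qstar_normal_spaceI_closure_nbhd) blast
  ultimately show ?thesis
    by argo
qed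

end
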